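(* Let $(L,\cdot,e_L)$ be a left quasigroup with a unit, $H=L$, let $G$ be a group with a bijection of sets $\pi:L\to G$, let $(L,m,\eta,\sigma)$ be the associated structure in $\mathrm{Set}_H$ (see context), let $(X,m_X)$ be a left $(L,m,\eta)$-module in $\mathrm{Set}_H$, and set $Y=L\otimes X$. Let $\lambda_0\in L$ be the unique element such that $\pi(\lambda_0)$ is the unit of $G$. (1) Let $(Y,m_Y)$ be a left $(L,m,\eta)$-module in $\mathrm{Set}_H$ such that $m_Xm_Y=m_X(1_L\otimes m_X)$ and such that the two pairs $(m_Y,m_Y^{\mathrm{triv}})$ and $(m_Y,m_Y^{\sigma})$ each braid-commute. Put $\theta_Y=m_Y^{\mathrm{triv}}(1_L\otimes m_Y)a_{LLY}:(L\otimes L)\otimes Y\to Y$. For $\lambda\in H$, $a,b\in L$, $x\in X$, let $a\,\square^{\lambda}_{x}\,b\in L$ denote the first component of $\theta_Y(\lambda)\big(\iota^\lambda(a),(b,m_X(\lambda b)((\lambda b)\backslash\lambda,x))\big)$, where $\iota^\lambda(a)=(a,(\lambda a)\backslash\lambda)$. For $x\in X$ define $f^{\lambda_0}_x:G\to G$ by $$f^{\lambda_0}_x(a)=\pi(\lambda_0)\,\pi\big(\lambda_0((\lambda_0\backslash\pi^{-1}(a))\,\square^{\lambda_0}_{x}\,e_L)\big)^{-1}a\qquad(a\in G).$$ Then $\{f^{\lambda_0}_x:G\to G\mid x\in X\}$ is a family of group homomorphisms. (2) Let $\{f^{\lambda_0}_x:G\to G\mid x\in X\}$ be a family of group homomorphisms.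 For $\lambda\in H$, $a,b\in L$, $x\in X$ define $$a\,\square^{\lambda}_{x}\,b=\lambda\backslash\pi^{-1}\Big(\pi(\lambda a)\pi(\lambda)^{-1}\pi(\lambda b)\,f^{\lambda_0}_{m_X(\lambda_0)(\lambda_0\backslash\lambda,x)}(\pi(\lambda))\,f^{\lambda_0}_{m_X(\lambda_0)(\lambda_0\backslash\lambda,x)}(\pi(\lambda a))^{-1}\Big),$$ $$m_Y(\lambda)(a,(b,x))=\big(\lambda\backslash c,\;m_X(c)(c\backslash(\lambda a),m_X(\lambda a)(b,x))\big),$$ where $c=(\lambda a)\big(((\lambda a)\backslash\lambda)\,\square^{\lambda a}_{m_X(\lambda a)(b,x)}\,b\big)\in L$. Then $m_Y:L\otimes Y\to Y$ is a morphism of $\mathrm{Set}_H$, and $(Y,m_Y)$ is a left $(L,m,\eta)$-module in $\mathrm{Set}_H$ such that $m_Xm_Y=m_X(1_L\otimes m_X)$ and such that the two pairs $(m_Y,m_Y^{\mathrm{triv}})$ and $(m_Y,m_Y^{\sigma})$ each braid-commute. (3) The correspondence $m_Y\mapsto\{f^{\lambda_0}_x\}_{x\in X}$ in (1) and the correspondence $\{f^{\lambda_0}_x\}_{x\in X}\mapsto m_Y$ in (2) are inverse to each other.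
   Context: Category $\mathrm{Set}_H$ ($H$ a nonempty set): objects are pairs $(X,\cdot_X)$ of a set $X$ and a map $\cdot_X:H\times X\to H$. A morphism $f:X\to Y$ is a map $f:H\to\mathrm{Map}(X,Y)$ with $\lambda\cdot_Yf(\lambda)(x)=\lambda\cdot_Xx$ for all $\lambda,x$; composition is $(gf)(\lambda)=g(\lambda)\circ f(\lambda)$. It is a tensor (monoidal) category: $X\otimes Y=X\times Y$ with $\lambda\cdot_{X\otimes Y}(x,y)=(\lambda\cdot_Xx)\cdot_Yy$; $(f\otimes g)(\lambda)(x,y)=(f(\lambda)(x),g(\lambda\cdot_Xx)(y))$; unit $I=\{\bullet\}$ with $\lambda\cdot_I\bullet=\lambda$; constraints $a_{XYZ}(\lambda)((x,y),z)=(x,(y,z))$, $l_X(\lambda)(\bullet,x)=x$, $r_X(\lambda)(x,\bullet)=x$. Left quasigroup with a unit $(L,\cdot,e_L)$: a set with a binary operation $(a,b)\mapsto ab$ such that for all $a,c\in L$ there is a unique $b\in L$ with $ab=c$ (denoted $b=a\backslash c$), and $ae_L=e_La=a$ for all $a$. With $H=L$, $L$ is an object of $\mathrm{Set}_H$ via its own operation. Structure on $L$ ($\lambda\in H$, $a,b\in L$): $m(\lambda)(a,b)=\lambda\backslash((\lambda a)b)$, $\eta(\lambda)(\bullet)=e_L$, $\sigma(\lambda)(a,b)=(\xi_\lambda(a,b),\eta_\lambda(a,b))$ with $\xi_\lambda(a,b)=\lambda\backslash\pi^{-1}(\pi(\lambda)\pi(\lambda a)^{-1}\pi((\lambda a)b))$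 and $\eta_\lambda(a,b)=(\lambda\xi_\lambda(a,b))\backslash((\lambda a)b)$. These define morphisms $m:L\otimes L\to L$, $\eta:I\to L$, $\sigma:L\otimes L\to L\otimes L$, and $(L,m,\eta)$ is a monoid in $\mathrm{Set}_H$. Left $(L,m,\eta)$-module $(V,m_V)$ in $\mathrm{Set}_H$: a morphism $m_V:L\otimes V\to V$ with $m_V(m\otimes1_V)=m_V(1_L\otimes m_V)a_{LLV}$ and $m_V(\eta\otimes1_V)=l_V$; i.e. $m_V(\lambda)(\lambda\backslash((\lambda a)b),v)=m_V(\lambda)(a,m_V(\lambda a)(b,v))$ and $m_V(\lambda)(e_L,v)=v$. For $Y=L\otimes X$: $m_Y^{\mathrm{triv}}=(m\otimes1_X)a_{LLX}^{-1}$ and $m_Y^\sigma=(1_L\otimes m_X)a_{LLX}(\sigma\otimes1_X)a_{LLX}^{-1}$, both $L\otimes Y\to Y$ (both are left module structures on $Y$). For two left module structures $m_V,m'_V$ on the same object $V$, the pair $(m_V,m'_V)$ braid-commutes iff $m_V(1_L\otimes m'_V)=m'_V(1_L\otimes m_V)a_{LLV}(\sigma\otimes1_V)a_{LLV}^{-1}$. *)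

theory Defs
  imports "HOL-Algebra.Group"
begin

section \<open>The tensor category of \<open>H\<close>-sets\<close>

text \<open>
  An object has an underlying (possibly empty) set \<open>hcarrier X\<close> and a map
  \<open>hact X\<close> from \<open>H \<times> hcarrier X\<close> to \<open>H\<close>. A morphism is a curried function
  \<open>\<lambda> \<mapsto> (x \<mapsto> f \<lambda> x)\<close>, of which only the values for \<open>\<lambda> \<in> H\<close> and \<open>x \<in> hcarrier X\<close> matter;
  hence equality of morphisms is \<open>mor_eq\<close>, not equality of HOL functions.
\<close>

record ('h, 'x) hobj =
  hcarrier :: "'x set"
  hact :: "'h \<Rightarrow> 'x \<Rightarrow> 'h"

type_synonym ('h, 'x, 'y) hmor = "'h \<Rightarrow> 'x \<Rightarrow> 'y"

definition is_obj :: "'h set \<Rightarrow> ('h, 'x) hobj \<Rightarrow> bool" where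
  "is_obj H X \<longleftrightarrow> (\<forall>l\<in>H. \<forall>x\<in>hcarrier X. hact X l x \<in> H)"

definition is_mor ::
  "'h set \<Rightarrow> ('h, 'x) hobj \<Rightarrow> ('h, 'y) hobj \<Rightarrow> ('h, 'x, 'y) hmor \<Rightarrow> bool" where
  "is_mor H X Y f \<longleftrightarrow>
     (\<forall>l\<in>H. \<forall>x\<in>hcarrier X. f l x \<in> hcarrier Y \<and> hact Y l (f l x) = hact X l x)"

definition mor_eq ::
  "'h set \<Rightarrow> ('h, 'x) hobj \<Rightarrow> ('h, 'x, 'y) hmor \<Rightarrow> ('h, 'x, 'y) hmor \<Rightarrow> bool" where
  "mor_eq H X f g \<longleftrightarrow> (\<forall>l\<in>H. \<forall>x\<in>hcarrier X. f l x = g l x)"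

definition id_mor :: "('h, 'x, 'x) hmor" where
  "id_mor = (\<lambda>l x. x)"

definition comp_mor ::
  "('h, 'y, 'z) hmor \<Rightarrow> ('h, 'x, 'y) hmor \<Rightarrow> ('h, 'x, 'z) hmor" (infixr "\<circ>\<^sub>H" 55) where
  "g \<circ>\<^sub>H f = (\<lambda>l x. g l (f l x))"

definition tensor_obj ::
  "('h, 'x) hobj \<Rightarrow> ('h, 'y) hobj \<Rightarrow> ('h, 'x \<times> 'y) hobj" where
  "tensor_obj X Y =
     \<lparr>hcarrier = hcarrier X \<times> hcarrier Y, hact = (\<lambda>l (x, y). hact Y (hact X l x) y)\<rparr>"

text \<open>In \<open>tensor_mor X f g\<close> the object \<open>X\<close> is the domain of \<open>f\<close>.\<close>

definition tensor_mor ::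
  "('h, 'x) hobj \<Rightarrow> ('h, 'x, 'x2) hmor \<Rightarrow> ('h, 'y, 'y2) hmor
     \<Rightarrow> ('h, 'x \<times> 'y, 'x2 \<times> 'y2) hmor" where
  "tensor_mor X f g = (\<lambda>l (x, y). (f l x, g (hact X l x) y))"

definition unit_obj :: "('h, unit) hobj" where
  "unit_obj = \<lparr>hcarrier = {()}, hact = (\<lambda>l _. l)\<rparr>"

definition assoc :: "('h, ('x \<times> 'y) \<times> 'z, 'x \<times> ('y \<times> 'z)) hmor" where
  "assoc = (\<lambda>l ((x, y), z). (x, (y, z)))"

definition assoc_inv :: "('h, 'x \<times> ('y \<times> 'z), ('x \<times> 'y) \<times> 'z) hmor" where
  "assoc_inv = (\<lambda>l (x, (y, z)). ((x, y), z))"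

definition lunit :: "('h, unit \<times> 'x, 'x) hmor" where
  "lunit = (\<lambda>l (_, x). x)"

text \<open>
  Left modules over a monoid object with underlying object \<open>A\<close>, multiplication \<open>m\<close> and
  unit \<open>u\<close>.
\<close>

definition left_module ::
  "'h set \<Rightarrow> ('h, 'a) hobj \<Rightarrow> ('h, 'a \<times> 'a, 'a) hmor \<Rightarrow> ('h, unit, 'a) hmor
     \<Rightarrow> ('h, 'v) hobj \<Rightarrow> ('h, 'a \<times> 'v, 'v) hmor \<Rightarrow> bool" where
  "left_module H A m u V mV \<longleftrightarrow>
     is_obj H V \<and>
     is_mor H (tensor_obj A V) V mV \<and>
     mor_eq H (tensor_obj (tensor_obj A A) V)
       (mV \<circ>\<^sub>H tensor_mor (tensor_obj A A) m id_mor)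
       (mV \<circ>\<^sub>H tensor_mor A id_mor mV \<circ>\<^sub>H assoc) \<and>
     mor_eq H (tensor_obj unit_obj V) (mV \<circ>\<^sub>H tensor_mor unit_obj u id_mor) lunit"

definition braid_commute ::
  "'h set \<Rightarrow> ('h, 'a) hobj \<Rightarrow> ('h, 'a \<times> 'a, 'a \<times> 'a) hmor
     \<Rightarrow> ('h, 'v) hobj \<Rightarrow> ('h, 'a \<times> 'v, 'v) hmor \<Rightarrow> ('h, 'a \<times> 'v, 'v) hmor \<Rightarrow> bool" where
  "braid_commute H A \<sigma> V mV mV' \<longleftrightarrow>
     mor_eq H (tensor_obj A (tensor_obj A V))
       (mV \<circ>\<^sub>H tensor_mor A id_mor mV')
       (mV' \<circ>\<^sub>H tensor_mor A id_mor mV \<circ>\<^sub>H assoc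
          \<circ>\<^sub>H tensor_mor (tensor_obj A A) \<sigma> id_mor \<circ>\<^sub>H assoc_inv)"

section \<open>Left quasigroups with a unit\<close>

text \<open>
  The HOL-Algebra record \<open>monoid\<close> only serves as the signature (carrier, product, unit element);
  associativity is not assumed.
\<close>

locale left_quasigroup_with_unit =
  fixes L (structure)
  assumes m_closed: "a \<in> carrier L \<Longrightarrow> b \<in> carrier L \<Longrightarrow> a \<otimes> b \<in> carrier L"
    and one_closed: "\<one> \<in> carrier L"
    and ex1_ldiv: "a \<in> carrier L \<Longrightarrow> c \<in> carrier L \<Longrightarrow> \<exists>!b. b \<in> carrier L \<and> a \<otimes> b = c"
    and r_one: "a \<in> carrier L \<Longrightarrow> a \<otimes> \<one> = a"
    and l_one: "a \<in> carrier L \<Longrightarrow> \<one> \<otimes> a = a"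

definition ldiv :: "('l, 'b) monoid_scheme \<Rightarrow> 'l \<Rightarrow> 'l \<Rightarrow> 'l" where
  "ldiv L a c = (THE b. b \<in> carrier L \<and> a \<otimes>\<^bsub>L\<^esub> b = c)"

definition L_obj :: "('l, 'b) monoid_scheme \<Rightarrow> ('l, 'l) hobj" where
  "L_obj L = \<lparr>hcarrier = carrier L, hact = (\<lambda>l a. l \<otimes>\<^bsub>L\<^esub> a)\<rparr>"

definition L_mult :: "('l, 'b) monoid_scheme \<Rightarrow> ('l, 'l \<times> 'l, 'l) hmor" where
  "L_mult L = (\<lambda>l (a, b). ldiv L l ((l \<otimes>\<^bsub>L\<^esub> a) \<otimes>\<^bsub>L\<^esub> b))"

definition L_unit :: "('l, 'b) monoid_scheme \<Rightarrow> ('l, unit, 'l) hmor" where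
  "L_unit L = (\<lambda>l _. \<one>\<^bsub>L\<^esub>)"

definition pi_inv :: "('l, 'b) monoid_scheme \<Rightarrow> ('l \<Rightarrow> 'g) \<Rightarrow> 'g \<Rightarrow> 'l" where
  "pi_inv L \<pi> = inv_into (carrier L) \<pi>"

definition sigma_fst ::
  "('l, 'b) monoid_scheme \<Rightarrow> ('g, 'c) monoid_scheme \<Rightarrow> ('l \<Rightarrow> 'g) \<Rightarrow> 'l \<Rightarrow> 'l \<Rightarrow> 'l \<Rightarrow> 'l" where
  "sigma_fst L G \<pi> l a b =
     ldiv L l (pi_inv L \<pi>
       (\<pi> l \<otimes>\<^bsub>G\<^esub> inv\<^bsub>G\<^esub> (\<pi> (l \<otimes>\<^bsub>L\<^esub> a)) \<otimes>\<^bsub>G\<^esub> \<pi> ((l \<otimes>\<^bsub>L\<^esub> a) \<otimes>\<^bsub>L\<^esub> b)))"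

definition sigma_snd ::
  "('l, 'b) monoid_scheme \<Rightarrow> ('g, 'c) monoid_scheme \<Rightarrow> ('l \<Rightarrow> 'g) \<Rightarrow> 'l \<Rightarrow> 'l \<Rightarrow> 'l \<Rightarrow> 'l" where
  "sigma_snd L G \<pi> l a b =
     ldiv L (l \<otimes>\<^bsub>L\<^esub> sigma_fst L G \<pi> l a b) ((l \<otimes>\<^bsub>L\<^esub> a) \<otimes>\<^bsub>L\<^esub> b)"

definition L_sigma ::
  "('l, 'b) monoid_scheme \<Rightarrow> ('g, 'c) monoid_scheme \<Rightarrow> ('l \<Rightarrow> 'g)
     \<Rightarrow> ('l, 'l \<times> 'l, 'l \<times> 'l) hmor" where
  "L_sigma L G \<pi> = (\<lambda>l (a, b). (sigma_fst L G \<pi> l a b, sigma_snd L G \<pi> l a b))"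

abbreviation L_module ::
  "('l, 'b) monoid_scheme \<Rightarrow> ('l, 'v) hobj \<Rightarrow> ('l, 'l \<times> 'v, 'v) hmor \<Rightarrow> bool" where
  "L_module L V mV \<equiv> left_module (carrier L) (L_obj L) (L_mult L) (L_unit L) V mV"

section \<open>The module structures on \<open>L \<otimes> X\<close>\<close>

abbreviation Y_obj :: "('l, 'b) monoid_scheme \<Rightarrow> ('l, 'x) hobj \<Rightarrow> ('l, 'l \<times> 'x) hobj" where
  "Y_obj L X \<equiv> tensor_obj (L_obj L) X"

definition mY_triv ::
  "('l, 'b) monoid_scheme \<Rightarrow> ('l, 'l \<times> ('l \<times> 'x), 'l \<times> 'x) hmor" where
  "mY_triv L = tensor_mor (tensor_obj (L_obj L) (L_obj L)) (L_mult L) id_mor \<circ>\<^sub>H assoc_inv"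

definition mY_sigma ::
  "('l, 'b) monoid_scheme \<Rightarrow> ('g, 'c) monoid_scheme \<Rightarrow> ('l \<Rightarrow> 'g)
     \<Rightarrow> ('l, 'l \<times> 'x, 'x) hmor \<Rightarrow> ('l, 'l \<times> ('l \<times> 'x), 'l \<times> 'x) hmor" where
  "mY_sigma L G \<pi> mX =
     tensor_mor (L_obj L) id_mor mX \<circ>\<^sub>H assoc
       \<circ>\<^sub>H tensor_mor (tensor_obj (L_obj L) (L_obj L)) (L_sigma L G \<pi>) id_mor \<circ>\<^sub>H assoc_inv"

definition admissible ::
  "('l, 'b) monoid_scheme \<Rightarrow> ('g, 'c) monoid_scheme \<Rightarrow> ('l \<Rightarrow> 'g)
     \<Rightarrow> ('l, 'x) hobj \<Rightarrow> ('l, 'l \<times> 'x, 'x) hmor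
     \<Rightarrow> ('l, 'l \<times> ('l \<times> 'x), 'l \<times> 'x) hmor \<Rightarrow> bool" where
  "admissible L G \<pi> X mX mY \<longleftrightarrow>
     L_module L (Y_obj L X) mY \<and>
     mor_eq (carrier L) (tensor_obj (L_obj L) (Y_obj L X))
       (mX \<circ>\<^sub>H mY) (mX \<circ>\<^sub>H tensor_mor (L_obj L) id_mor mX) \<and>
     braid_commute (carrier L) (L_obj L) (L_sigma L G \<pi>) (Y_obj L X) mY (mY_triv L) \<and>
     braid_commute (carrier L) (L_obj L) (L_sigma L G \<pi>) (Y_obj L X) mY (mY_sigma L G \<pi> mX)"

subsection \<open>From module structures to families of maps\<close>

definition theta_Y ::
  "('l, 'b) monoid_scheme \<Rightarrow> ('l, 'l \<times> ('l \<times> 'x), 'l \<times> 'x) hmor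
     \<Rightarrow> ('l, ('l \<times> 'l) \<times> ('l \<times> 'x), 'l \<times> 'x) hmor" where
  "theta_Y L mY = mY_triv L \<circ>\<^sub>H tensor_mor (L_obj L) id_mor mY \<circ>\<^sub>H assoc"

definition iota :: "('l, 'b) monoid_scheme \<Rightarrow> 'l \<Rightarrow> 'l \<Rightarrow> 'l \<times> 'l" where
  "iota L l a = (a, ldiv L (l \<otimes>\<^bsub>L\<^esub> a) l)"

definition box_of_mod ::
  "('l, 'b) monoid_scheme \<Rightarrow> ('l, 'l \<times> 'x, 'x) hmor \<Rightarrow> ('l, 'l \<times> ('l \<times> 'x), 'l \<times> 'x) hmor
     \<Rightarrow> 'l \<Rightarrow> 'x \<Rightarrow> 'l \<Rightarrow> 'l \<Rightarrow> 'l" where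
  "box_of_mod L mX mY l x a b =
     fst (theta_Y L mY l
       (iota L l a, (b, mX (l \<otimes>\<^bsub>L\<^esub> b) (ldiv L (l \<otimes>\<^bsub>L\<^esub> b) l, x))))"

definition fam_of_mod ::
  "('l, 'b) monoid_scheme \<Rightarrow> ('g, 'c) monoid_scheme \<Rightarrow> ('l \<Rightarrow> 'g) \<Rightarrow> 'l
     \<Rightarrow> ('l, 'l \<times> 'x, 'x) hmor \<Rightarrow> ('l, 'l \<times> ('l \<times> 'x), 'l \<times> 'x) hmor
     \<Rightarrow> 'x \<Rightarrow> 'g \<Rightarrow> 'g" where
  "fam_of_mod L G \<pi> l0 mX mY x a =
     \<pi> l0 \<otimes>\<^bsub>G\<^esub>
     inv\<^bsub>G\<^esub> (\<pi> (l0 \<otimes>\<^bsub>L\<^esub> box_of_mod L mX mY l0 x (ldiv L l0 (pi_inv L \<pi> a)) \<one>\<^bsub>L\<^esub>)) \<otimes>\<^bsub>G\<^esub> a"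

subsection \<open>From families of homomorphisms to module structures\<close>

definition box_of_fam ::
  "('l, 'b) monoid_scheme \<Rightarrow> ('g, 'c) monoid_scheme \<Rightarrow> ('l \<Rightarrow> 'g) \<Rightarrow> 'l
     \<Rightarrow> ('l, 'l \<times> 'x, 'x) hmor \<Rightarrow> ('x \<Rightarrow> 'g \<Rightarrow> 'g) \<Rightarrow> 'l \<Rightarrow> 'x \<Rightarrow> 'l \<Rightarrow> 'l \<Rightarrow> 'l" where
  "box_of_fam L G \<pi> l0 mX f l x a b =
     (let x' = mX l0 (ldiv L l0 l, x) in
      ldiv L l (pi_inv L \<pi>
        (\<pi> (l \<otimes>\<^bsub>L\<^esub> a) \<otimes>\<^bsub>G\<^esub> inv\<^bsub>G\<^esub> (\<pi> l) \<otimes>\<^bsub>G\<^esub> \<pi> (l \<otimes>\<^bsub>L\<^esub> b)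
          \<otimes>\<^bsub>G\<^esub> f x' (\<pi> l) \<otimes>\<^bsub>G\<^esub> inv\<^bsub>G\<^esub> (f x' (\<pi> (l \<otimes>\<^bsub>L\<^esub> a))))))"

definition mod_of_fam ::
  "('l, 'b) monoid_scheme \<Rightarrow> ('g, 'c) monoid_scheme \<Rightarrow> ('l \<Rightarrow> 'g) \<Rightarrow> 'l
     \<Rightarrow> ('l, 'l \<times> 'x, 'x) hmor \<Rightarrow> ('x \<Rightarrow> 'g \<Rightarrow> 'g)
     \<Rightarrow> ('l, 'l \<times> ('l \<times> 'x), 'l \<times> 'x) hmor" where
  "mod_of_fam L G \<pi> l0 mX f = (\<lambda>l (a, (b, x)).
     let la = l \<otimes>\<^bsub>L\<^esub> a;
         x' = mX la (b, x);
         c = la \<otimes>\<^bsub>L\<^esub> box_of_fam L G \<pi> l0 mX f la x' (ldiv L la l) b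
     in (ldiv L l c, mX c (ldiv L c la, x')))"

end

theory Submission
  imports Defs
begin

text \<open>
  Replace the relative coordinates by absolute ones: a path \<open>\<lambda>, a, b, \<dots>\<close> becomes the sequence of
  its vertices \<open>\<lambda>, \<lambda>a, (\<lambda>a)b, \<dots>\<close>, and an element \<open>x\<close> sitting at the vertex \<open>\<nu>\<close> is transported to
  \<open>\<lambda>\<^sub>0\<close> by the module structure of \<open>X\<close>. In these coordinates \<open>m\<^sub>X\<close> forgets a vertex, and a
  structure \<open>m\<^sub>Y\<close> with \<open>m\<^sub>X m\<^sub>Y = m\<^sub>X (1 \<otimes> m\<^sub>X)\<close> maps \<open>(\<lambda>, \<mu>, \<nu>, y)\<close> to \<open>(\<lambda>, F\<^sub>y(\<lambda>, \<mu>, \<nu>), y)\<close>.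
  Identify \<open>L\<close> with \<open>G\<close> through \<open>\<pi>\<close>. Commutation with the trivial structure says
  \<open>F\<^sub>y(\<lambda>, \<mu>, \<nu>) = K\<^sub>y(\<lambda>\<mu>\<^sup>-\<^sup>1, \<nu>)\<close>, the module axioms say that \<open>K\<^sub>y\<close> is an action of \<open>G\<close>, and commutation with
  the structure given by \<open>\<sigma>\<close> says \<open>K\<^sub>y(g, hr) = g h g\<^sup>-\<^sup>1 K\<^sub>y(g, r)\<close>. Hence
  \<open>K\<^sub>y(g, r) = g r f\<^sub>y(g)\<^sup>-\<^sup>1\<close>, and the action property of \<open>K\<^sub>y\<close> means that \<open>f\<^sub>y\<close> is a homomorphism.
\<close>

section \<open>Twisted actions of a group on itself\<close>

context group
begin

lemma inv_mult_cancel_left: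
  "x \<in> carrier G \<Longrightarrow> y \<in> carrier G \<Longrightarrow> inv x \<otimes> (x \<otimes> y) = y"
  by (simp add: m_assoc[symmetric])

lemma mult_inv_cancel_left:
  "x \<in> carrier G \<Longrightarrow> y \<in> carrier G \<Longrightarrow> x \<otimes> (inv x \<otimes> y) = y"
  by (simp add: m_assoc[symmetric])

lemmas group_normalize = m_assoc inv_mult_group inv_mult_cancel_left mult_inv_cancel_left

text \<open>Taking \<open>h := r\<close> and \<open>r := \<one>\<close> in \<open>conj\<close> shows
  that \<open>K g\<close> is determined by \<open>K g \<one>\<close>, which \<open>f g\<close>
  encodes because \<open>inv (f g) = inv g \<otimes> K g \<one>\<close>. With \<open>K\<close> in
  this form, \<open>act\<close> at \<open>\<one>\<close> compares \<open>f g \<otimes> f h\<close>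
  with \<open>f (g \<otimes> h)\<close>.\<close>

lemma twisted_action:
  assumes closed: "\<And>g r. g \<in> carrier G \<Longrightarrow> r \<in> carrier G \<Longrightarrow> K g r \<in> carrier G"
    and act: "\<And>g h r. g \<in> carrier G \<Longrightarrow> h \<in> carrier G \<Longrightarrow> r \<in> carrier G \<Longrightarrow>
      K g (K h r) = K (g \<otimes> h) r"
    and conj: "\<And>g h r. g \<in> carrier G \<Longrightarrow> h \<in> carrier G \<Longrightarrow> r \<in> carrier G \<Longrightarrow>
      K g (h \<otimes> r) = g \<otimes> h \<otimes> inv g \<otimes> K g r"
  defines "f \<equiv> \<lambda>g. inv (K g \<one>) \<otimes> g"
  shows "f \<in> hom G G"
    and "g \<in> carrier G \<Longrightarrow> r \<in> carrier G \<Longrightarrow> K g r = g \<otimes> r \<otimes> inv (f g)"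
proof -
  have fc: "f g \<in> carrier G" if "g \<in> carrier G" for g
    using that closed by (simp add: f_def)
  show form: "K g r = g \<otimes> r \<otimes> inv (f g)" if "g \<in> carrier G" "r \<in> carrier G" for g r
    using conj[of g r \<one>] that closed by (simp add: f_def group_normalize)
  have "f (g \<otimes> h) = f g \<otimes> f h" if gh: "g \<in> carrier G" "h \<in> carrier G" for g h
  proof -
    have "(g \<otimes> h) \<otimes> inv (f g \<otimes> f h) = (g \<otimes> h) \<otimes> inv (f (g \<otimes> h))"
      using act[of g h \<one>] gh fc by (simp add: form group_normalize)
    then show ?thesis
      using gh fc by (metis inv_closed inv_inv Units_eq Units_l_cancel m_closed)
  qed
  then show "f \<in> hom G G"
    using fc by (auto simp: hom_def)
qed

end

section \<open>Left division\<close>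

context left_quasigroup_with_unit
begin

lemma ldiv_closed [simp]: "a \<in> carrier L \<Longrightarrow> c \<in> carrier L \<Longrightarrow> ldiv L a c \<in> carrier L"
  and mult_ldiv [simp]: "a \<in> carrier L \<Longrightarrow> c \<in> carrier L \<Longrightarrow> a \<otimes> ldiv L a c = c"
  unfolding ldiv_def using theI'[OF ex1_ldiv[of a c]] by auto

lemma ldiv_mult [simp]: "a \<in> carrier L \<Longrightarrow> b \<in> carrier L \<Longrightarrow> ldiv L a (a \<otimes> b) = b"
  by (metis ex1_ldiv ldiv_closed m_closed mult_ldiv)

lemma ldiv_self [simp]: "a \<in> carrier L \<Longrightarrow> ldiv L a a = \<one>"
  by (metis ldiv_mult one_closed r_one)

lemma ldiv_left_cancel [simp]:
  "a \<in> carrier L \<Longrightarrow> b \<in> carrier L \<Longrightarrow> c \<in> carrier L \<Longrightarrow> ldiv L a b = ldiv L a c \<longleftrightarrow> b = c"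
  by (metis mult_ldiv)

text \<open>Trades a quantifier over the step \<open>a\<close> for one over the end vertex
  \<open>m = l \<otimes> a\<close>.\<close>

lemma ball_ldiv_iff:
  assumes "l \<in> carrier L"
  shows "(\<forall>a\<in>carrier L. P a) \<longleftrightarrow> (\<forall>m\<in>carrier L. P (ldiv L l m))"
  using assms by (metis ldiv_closed ldiv_mult m_closed)

end

section \<open>The module \<open>X\<close> and the points of \<open>L \<otimes> X\<close> in
  absolute coordinates\<close>

locale quasigroup_module =
  left_quasigroup_with_unit L + G: group G
  for L :: "('l, 'b) monoid_scheme" (structure) and G :: "('g, 'c) monoid_scheme" +
  fixes \<pi> :: "'l \<Rightarrow> 'g" and X :: "('l, 'x) hobj" and mX :: "('l, 'l \<times> 'x, 'x) hmor"
    and l0 :: 'l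
  assumes bij: "bij_betw \<pi> (carrier L) (carrier G)"
    and module_X: "L_module L X mX"
    and l0_closed [simp]: "l0 \<in> carrier L"
    and \<pi>_l0 [simp]: "\<pi> l0 = \<one>\<^bsub>G\<^esub>"
begin

abbreviation E :: "'g \<Rightarrow> 'l" where "E \<equiv> pi_inv L \<pi>"

lemma \<pi>_closed [simp]: "l \<in> carrier L \<Longrightarrow> \<pi> l \<in> carrier G"
  using bij by (auto simp: bij_betw_def)

lemma E_closed [simp]: "g \<in> carrier G \<Longrightarrow> E g \<in> carrier L"
  and \<pi>_E [simp]: "g \<in> carrier G \<Longrightarrow> \<pi> (E g) = g"
  and E_\<pi> [simp]: "l \<in> carrier L \<Longrightarrow> E (\<pi> l) = l"
  using bij unfolding pi_inv_def bij_betw_def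
  by (auto simp: inv_into_into f_inv_into_f inv_into_f_f)

lemma E_one [simp]: "E \<one>\<^bsub>G\<^esub> = l0"
  by (metis E_\<pi> \<pi>_l0 l0_closed)

text \<open>Transport of an element of \<open>X\<close> from the vertex \<open>m\<close> to the vertex \<open>l\<close>.\<close>

definition T :: "'l \<Rightarrow> 'l \<Rightarrow> 'x \<Rightarrow> 'x" where
  "T l m x = mX l (ldiv L l m, x)"

lemma T_closed [simp]:
    "l \<in> carrier L \<Longrightarrow> m \<in> carrier L \<Longrightarrow> x \<in> hcarrier X \<Longrightarrow> T l m x \<in> hcarrier X"
  and hact_T: "l \<in> carrier L \<Longrightarrow> m \<in> carrier L \<Longrightarrow> x \<in> hcarrier X \<Longrightarrow>
    hact X l (T l m x) = hact X m x"
  using module_X by (auto simp: left_module_def is_mor_def tensor_obj_def L_obj_def T_def)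

lemma T_T [simp]:
  assumes "l \<in> carrier L" "m \<in> carrier L" "n \<in> carrier L" "x \<in> hcarrier X"
  shows "T l m (T m n x) = T l n x"
proof -
  have "mX l (L_mult L l (a, b), x) = mX l (a, mX (l \<otimes> a) (b, x))"
    if "a \<in> carrier L" "b \<in> carrier L" for a b
    using module_X assms that
    by (auto simp: left_module_def mor_eq_def comp_mor_def tensor_mor_def tensor_obj_def
        L_obj_def id_mor_def assoc_def)
  \<comment> \<open>For these two steps the path starting at \<open>l\<close> has the vertices
    \<open>l\<close>, \<open>m\<close>, \<open>n\<close>.\<close>
  from this[of "ldiv L l m" "ldiv L m n"] show ?thesis
    using assms by (simp add: T_def L_mult_def)
qed

lemma T_self [simp]: "l \<in> carrier L \<Longrightarrow> x \<in> hcarrier X \<Longrightarrow> T l l x = x"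
  using module_X by (auto simp: left_module_def mor_eq_def comp_mor_def tensor_mor_def
      tensor_obj_def unit_obj_def id_mor_def lunit_def L_unit_def T_def)

text \<open>The element of \<open>L \<otimes> X\<close> at \<open>l\<close> with vertex \<open>n\<close> and transported second component \<open>y\<close>.\<close>

definition pt :: "'l \<Rightarrow> 'l \<Rightarrow> 'x \<Rightarrow> 'l \<times> 'x" where
  "pt l n y = (ldiv L l n, T n l0 y)"

text \<open>The transport \<open>T n l0\<close> is undone by \<open>T l0 n\<close>, so a point
  determines its coordinates.\<close>

lemma pt_eq_iff [simp]:
  assumes "l \<in> carrier L" "n \<in> carrier L" "p \<in> carrier L" "y \<in> hcarrier X" "z \<in> hcarrier X"
  shows "pt l n y = pt l p z \<longleftrightarrow> n = p \<and> y = z"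
  using assms by (metis T_T T_self l0_closed ldiv_left_cancel pt_def prod.inject)

lemma pt_closed [simp]:
  "l \<in> carrier L \<Longrightarrow> n \<in> carrier L \<Longrightarrow> y \<in> hcarrier X \<Longrightarrow> pt l n y \<in> hcarrier (Y_obj L X)"
  by (simp add: pt_def tensor_obj_def L_obj_def)

text \<open>Transport preserves \<open>hact\<close>, so neither the base \<open>l\<close> nor the
  vertex \<open>n\<close> influences the result. This is why a map that changes vertices only is a
  morphism.\<close>

lemma hact_pt:
  "l \<in> carrier L \<Longrightarrow> n \<in> carrier L \<Longrightarrow> y \<in> hcarrier X \<Longrightarrow>
    hact (Y_obj L X) l (pt l n y) = hact X l0 y"
  by (simp add: pt_def tensor_obj_def L_obj_def hact_T)

lemma ptE:
  assumes "v \<in> hcarrier (Y_obj L X)" "l \<in> carrier L"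
  obtains n y where "n \<in> carrier L" "y \<in> hcarrier X" "v = pt l n y"
proof -
  obtain b x where v: "v = (b, x)" "b \<in> carrier L" "x \<in> hcarrier X"
    using assms by (auto simp: tensor_obj_def L_obj_def)
  then have "v = pt l (l \<otimes> b) (T l0 (l \<otimes> b) x)"
    using assms by (simp add: pt_def m_closed)
  then show ?thesis
    using that[of "l \<otimes> b" "T l0 (l \<otimes> b) x"] v assms by (simp add: m_closed)
qed

lemma ball_pt_iff:
  assumes "l \<in> carrier L"
  shows "(\<forall>v\<in>hcarrier (Y_obj L X). P v) \<longleftrightarrow>
    (\<forall>n\<in>carrier L. \<forall>y\<in>hcarrier X. P (pt l n y))"
  using assms by (metis ptE pt_closed)

lemma ball_L_pt_iff:
  assumes l: "l \<in> carrier L"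
  shows "(\<forall>v\<in>hcarrier (tensor_obj (L_obj L) (Y_obj L X)). P v) \<longleftrightarrow>
    (\<forall>m\<in>carrier L. \<forall>n\<in>carrier L. \<forall>y\<in>hcarrier X. P (ldiv L l m, pt m n y))"
proof -
  have "(\<forall>v\<in>hcarrier (tensor_obj (L_obj L) (Y_obj L X)). P v) \<longleftrightarrow>
      (\<forall>a\<in>carrier L. \<forall>v\<in>hcarrier (Y_obj L X). P (a, v))"
    by (simp add: tensor_obj_def L_obj_def)
  also note ball_ldiv_iff[OF l]
  finally show ?thesis
    using l by (simp add: ball_pt_iff)
qed

lemma ball_L_L_pt_iff:
  assumes l: "l \<in> carrier L"
  shows "(\<forall>v\<in>hcarrier (tensor_obj (L_obj L) (tensor_obj (L_obj L) (Y_obj L X))). P v) \<longleftrightarrow>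
    (\<forall>m\<in>carrier L. \<forall>n\<in>carrier L. \<forall>r\<in>carrier L. \<forall>y\<in>hcarrier X.
      P (ldiv L l m, (ldiv L m n, pt n r y)))"
proof -
  have "(\<forall>v\<in>hcarrier (tensor_obj (L_obj L) (tensor_obj (L_obj L) (Y_obj L X))). P v) \<longleftrightarrow>
      (\<forall>a\<in>carrier L. \<forall>v\<in>hcarrier (tensor_obj (L_obj L) (Y_obj L X)). P (a, v))"
    by (simp add: tensor_obj_def L_obj_def)
  also note ball_ldiv_iff[OF l]
  finally show ?thesis
    using l by (simp add: ball_L_pt_iff)
qed

lemma ball_LL_pt_iff:
  assumes l: "l \<in> carrier L"
  shows "(\<forall>v\<in>hcarrier (tensor_obj (tensor_obj (L_obj L) (L_obj L)) (Y_obj L X)). P v) \<longleftrightarrow>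
    (\<forall>m\<in>carrier L. \<forall>n\<in>carrier L. \<forall>r\<in>carrier L. \<forall>y\<in>hcarrier X.
      P ((ldiv L l m, ldiv L m n), pt n r y))"
proof -
  have "(\<forall>v\<in>hcarrier (tensor_obj (tensor_obj (L_obj L) (L_obj L)) (Y_obj L X)). P v) \<longleftrightarrow>
      (\<forall>v\<in>hcarrier (tensor_obj (L_obj L) (tensor_obj (L_obj L) (Y_obj L X))).
        P ((fst v, fst (snd v)), snd (snd v)))"
    by (auto simp: tensor_obj_def L_obj_def)
  then show ?thesis
    using l by (simp add: ball_L_L_pt_iff)
qed

section \<open>The structure maps in absolute coordinates\<close>

lemma hact_L [simp]: "hact (L_obj L) l a = l \<otimes> a"
  by (simp add: L_obj_def)

lemma hact_LL [simp]: "hact (tensor_obj (L_obj L) (L_obj L)) l (a, b) = (l \<otimes> a) \<otimes> b"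
  by (simp add: L_obj_def tensor_obj_def)

lemma L_mult_ldiv [simp]:
  "l \<in> carrier L \<Longrightarrow> m \<in> carrier L \<Longrightarrow> n \<in> carrier L \<Longrightarrow>
    L_mult L l (ldiv L l m, ldiv L m n) = ldiv L l n"
  by (simp add: L_mult_def)

text \<open>The ternary heap operation of the group \<open>G\<close>, carried over to
  \<open>L\<close>. In terms of vertices, \<open>\<sigma>\<close> fixes the ends of a path
  \<open>l, m, n\<close> and puts \<open>twist l m n\<close> in the middle.\<close>

definition twist :: "'l \<Rightarrow> 'l \<Rightarrow> 'l \<Rightarrow> 'l" where
  "twist l m n = E (\<pi> l \<otimes>\<^bsub>G\<^esub> inv\<^bsub>G\<^esub> \<pi> m \<otimes>\<^bsub>G\<^esub> \<pi> n)"

lemma twist_closed [simp]: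
  "l \<in> carrier L \<Longrightarrow> m \<in> carrier L \<Longrightarrow> n \<in> carrier L \<Longrightarrow> twist l m n \<in> carrier L"
  by (simp add: twist_def)

lemma \<pi>_twist [simp]:
  "l \<in> carrier L \<Longrightarrow> m \<in> carrier L \<Longrightarrow> n \<in> carrier L \<Longrightarrow>
    \<pi> (twist l m n) = \<pi> l \<otimes>\<^bsub>G\<^esub> inv\<^bsub>G\<^esub> \<pi> m \<otimes>\<^bsub>G\<^esub> \<pi> n"
  by (simp add: twist_def)

lemma L_sigma_ldiv [simp]:
  "l \<in> carrier L \<Longrightarrow> m \<in> carrier L \<Longrightarrow> n \<in> carrier L \<Longrightarrow>
    L_sigma L G \<pi> l (ldiv L l m, ldiv L m n) =
      (ldiv L l (twist l m n), ldiv L (twist l m n) n)"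
  by (simp add: L_sigma_def sigma_fst_def sigma_snd_def twist_def)

lemma mX_pt [simp]:
  "l \<in> carrier L \<Longrightarrow> m \<in> carrier L \<Longrightarrow> y \<in> hcarrier X \<Longrightarrow> mX l (pt l m y) = T l l0 y"
  by (simp add: pt_def T_def[symmetric])

lemma mX_ldiv_T:
  "l \<in> carrier L \<Longrightarrow> m \<in> carrier L \<Longrightarrow> y \<in> hcarrier X \<Longrightarrow> mX l (ldiv L l m, T m l0 y) = T l l0 y"
  by (simp add: T_def[symmetric])

lemma mY_triv_pt [simp]:
  "l \<in> carrier L \<Longrightarrow> m \<in> carrier L \<Longrightarrow> n \<in> carrier L \<Longrightarrow>
    mY_triv L l (ldiv L l m, pt m n y) = pt l n y"
  by (simp add: mY_triv_def pt_def comp_mor_def tensor_mor_def assoc_inv_def id_mor_def)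

lemma mY_sigma_pt [simp]:
  "l \<in> carrier L \<Longrightarrow> m \<in> carrier L \<Longrightarrow> n \<in> carrier L \<Longrightarrow> y \<in> hcarrier X \<Longrightarrow>
    mY_sigma L G \<pi> mX l (ldiv L l m, pt m n y) = pt l (twist l m n) y"
  by (simp add: mY_sigma_def pt_def comp_mor_def tensor_mor_def assoc_inv_def assoc_def
      id_mor_def mX_ldiv_T)

section \<open>Structures on \<open>L \<otimes> X\<close> as vertex functions\<close>

text \<open>A relation, so that the same lemmas serve both a function read off from a given
  \<open>mY\<close> and the explicit \<open>F_of_fam\<close>.\<close>

definition represents ::
  "('x \<Rightarrow> 'l \<Rightarrow> 'l \<Rightarrow> 'l \<Rightarrow> 'l) \<Rightarrow> ('l, 'l \<times> ('l \<times> 'x), 'l \<times> 'x) hmor \<Rightarrow> bool" where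
  "represents F mY \<longleftrightarrow> (\<forall>l\<in>carrier L. \<forall>m\<in>carrier L. \<forall>n\<in>carrier L. \<forall>y\<in>hcarrier X.
     F y l m n \<in> carrier L \<and> mY l (ldiv L l m, pt m n y) = pt l (F y l m n) y)"

lemma representsD:
  assumes "represents F mY"
    and "l \<in> carrier L" "m \<in> carrier L" "n \<in> carrier L" "y \<in> hcarrier X"
  shows "F y l m n \<in> carrier L" "mY l (ldiv L l m, pt m n y) = pt l (F y l m n) y"
  using assms by (auto simp: represents_def)

lemma represents_is_mor:
  assumes "represents F mY"
  shows "is_mor (carrier L) (tensor_obj (L_obj L) (Y_obj L X)) (Y_obj L X) mY"
proof -
  have "hact (tensor_obj (L_obj L) (Y_obj L X)) l (ldiv L l m, pt m n y) = hact X l0 y"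
    if "l \<in> carrier L" "m \<in> carrier L" "n \<in> carrier L" "y \<in> hcarrier X" for l m n y
    using that hact_pt[of m n y] by (simp add: tensor_obj_def[of "L_obj L" "Y_obj L X"])
  then show ?thesis
    using representsD[OF assms] by (simp add: is_mor_def ball_L_pt_iff hact_pt)
qed

lemma represents_mor_eq:
  assumes "represents F mY" "represents F mY'"
  shows "mor_eq (carrier L) (tensor_obj (L_obj L) (Y_obj L X)) mY mY'"
  using representsD(2)[OF assms(1)] representsD(2)[OF assms(2)]
  by (simp add: mor_eq_def ball_L_pt_iff)

lemma is_obj_Y: "is_obj (carrier L) (Y_obj L X)"
  using module_X by (auto simp: is_obj_def left_module_def tensor_obj_def L_obj_def m_closed)

lemma represents_module_iff:
  assumes F: "represents F mY"
  shows "L_module L (Y_obj L X) mY \<longleftrightarrow>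
    (\<forall>l\<in>carrier L. \<forall>m\<in>carrier L. \<forall>n\<in>carrier L. \<forall>r\<in>carrier L. \<forall>y\<in>hcarrier X.
       F y l n r = F y l m (F y m n r)) \<and>
    (\<forall>l\<in>carrier L. \<forall>r\<in>carrier L. \<forall>y\<in>hcarrier X. F y l l r = r)"
proof -
  note [simp] = representsD[OF F]
  \<comment> \<open>Since \<open>\<one>\<close> is \<open>ldiv L l l\<close>, the unit law concerns
    paths with a repeated first vertex.\<close>
  have "mY l (\<one>, pt l r y) = pt l (F y l l r) y"
    if "l \<in> carrier L" "r \<in> carrier L" "y \<in> hcarrier X" for l r y
    using representsD(2)[OF F, of l l r y] that by simp
  moreover have "(\<forall>v\<in>hcarrier (tensor_obj unit_obj (Y_obj L X)). P v) \<longleftrightarrow>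
      (\<forall>r\<in>carrier L. \<forall>y\<in>hcarrier X. P ((), pt l r y))"
    if "l \<in> carrier L" for l and P :: "unit \<times> 'l \<times> 'x \<Rightarrow> bool"
  proof -
    have "(\<forall>v\<in>hcarrier (tensor_obj unit_obj (Y_obj L X)). P v) \<longleftrightarrow>
        (\<forall>v\<in>hcarrier (Y_obj L X). P ((), v))"
      by (simp add: tensor_obj_def unit_obj_def)
    then show ?thesis
      using that by (simp add: ball_pt_iff)
  qed
  ultimately show ?thesis
    by (simp add: left_module_def is_obj_Y represents_is_mor[OF F] mor_eq_def ball_LL_pt_iff
        comp_mor_def tensor_mor_def id_mor_def assoc_def lunit_def L_unit_def unit_obj_def)
qed

lemma represents_mX:
  assumes F: "represents F mY"
  shows "mor_eq (carrier L) (tensor_obj (L_obj L) (Y_obj L X))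
    (mX \<circ>\<^sub>H mY) (mX \<circ>\<^sub>H tensor_mor (L_obj L) id_mor mX)"
  using representsD[OF F]
  by (simp add: mor_eq_def ball_L_pt_iff comp_mor_def tensor_mor_def id_mor_def mX_ldiv_T)

text \<open>On a path \<open>l, m, n, r\<close> the left side drops \<open>n\<close> before applying
  \<open>F\<close>. The right side replaces \<open>m\<close> by the twist, applies \<open>F\<close>
  from there and then drops the twist.\<close>

lemma represents_braid_triv_iff:
  assumes F: "represents F mY"
  shows "braid_commute (carrier L) (L_obj L) (L_sigma L G \<pi>) (Y_obj L X) mY (mY_triv L) \<longleftrightarrow>
    (\<forall>l\<in>carrier L. \<forall>m\<in>carrier L. \<forall>n\<in>carrier L. \<forall>r\<in>carrier L. \<forall>y\<in>hcarrier X.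
       F y l m r = F y (twist l m n) n r)"
  using representsD[OF F]
  by (simp add: braid_commute_def mor_eq_def ball_L_L_pt_iff comp_mor_def tensor_mor_def
      id_mor_def assoc_def assoc_inv_def)

lemma represents_braid_sigma_iff:
  assumes F: "represents F mY"
  shows "braid_commute (carrier L) (L_obj L) (L_sigma L G \<pi>) (Y_obj L X) mY (mY_sigma L G \<pi> mX) \<longleftrightarrow>
    (\<forall>l\<in>carrier L. \<forall>m\<in>carrier L. \<forall>n\<in>carrier L. \<forall>r\<in>carrier L. \<forall>y\<in>hcarrier X.
       F y l m (twist m n r) = twist l (twist l m n) (F y (twist l m n) n r))"
  using representsD[OF F]
  by (simp add: braid_commute_def mor_eq_def ball_L_L_pt_iff comp_mor_def tensor_mor_def
      id_mor_def assoc_def assoc_inv_def)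

text \<open>The condition relating \<open>mY\<close> to \<open>mX\<close> forces \<open>mY\<close>
  to preserve the transported component, since transport is injective. Only the vertex can
  change.\<close>

lemma admissible_represented:
  assumes "admissible L G \<pi> X mX mY"
  obtains F where "represents F mY"
proof -
  define F where "F y l m n = l \<otimes> fst (mY l (ldiv L l m, pt m n y))" for y l m n
  have "F y l m n \<in> carrier L \<and> mY l (ldiv L l m, pt m n y) = pt l (F y l m n) y"
    if c: "l \<in> carrier L" "m \<in> carrier L" "n \<in> carrier L" "y \<in> hcarrier X" for l m n y
  proof -
    let ?v = "(ldiv L l m, pt m n y)"
    have "mY l ?v \<in> hcarrier (Y_obj L X)"
      using assms c by (simp add: admissible_def left_module_def is_mor_def ball_L_pt_iff)
    then obtain p z where p: "p \<in> carrier L" "z \<in> hcarrier X" "mY l ?v = pt l p z"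
      using c by (meson ptE)
    have "mX l (mY l ?v) = mX l (ldiv L l m, mX m (pt m n y))"
      using assms c by (simp add: admissible_def mor_eq_def ball_L_pt_iff comp_mor_def
          tensor_mor_def id_mor_def)
    then have "T l l0 z = T l l0 y"
      using c p by (simp add: mX_ldiv_T)
    then have "z = y"
      using c p by (metis T_T T_self l0_closed)
    moreover have "F y l m n = p"
      using c p by (simp add: F_def pt_def)
    ultimately show ?thesis
      using p by simp
  qed
  then show ?thesis
    by (intro that[of F]) (simp add: represents_def)
qed

section \<open>The two directions of the correspondence\<close>

text \<open>For a homomorphism \<open>f y\<close> the last two factors are the inverse of
  \<open>f y\<close> at \<open>\<pi> l \<otimes> inv \<pi> m\<close>. Written separately, they match
  \<open>box_of_fam\<close>.\<close>

definition F_of_fam :: "('x \<Rightarrow> 'g \<Rightarrow> 'g) \<Rightarrow> 'x \<Rightarrow> 'l \<Rightarrow> 'l \<Rightarrow> 'l \<Rightarrow> 'l" where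
  "F_of_fam f y l m n = E (\<pi> l \<otimes>\<^bsub>G\<^esub> inv\<^bsub>G\<^esub> \<pi> m \<otimes>\<^bsub>G\<^esub> \<pi> n \<otimes>\<^bsub>G\<^esub> f y (\<pi> m) \<otimes>\<^bsub>G\<^esub> inv\<^bsub>G\<^esub> f y (\<pi> l))"

lemma represents_mod_of_fam:
  assumes f: "\<forall>x\<in>hcarrier X. f x \<in> hom G G"
  shows "represents (F_of_fam f) (mod_of_fam L G \<pi> l0 mX f)"
  unfolding represents_def
proof (intro ballI conjI)
  fix l m n y
  assume c [simp]: "l \<in> carrier L" "m \<in> carrier L" "n \<in> carrier L" "y \<in> hcarrier X"
  have fc [simp]: "f y g \<in> carrier G" if "g \<in> carrier G" for g
    using f that by (auto simp: hom_def)
  show Fc: "F_of_fam f y l m n \<in> carrier L"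
    by (simp add: F_of_fam_def)
  \<comment> \<open>\<open>box_of_fam\<close> selects its map by transporting to \<open>l0\<close>;
    here this recovers \<open>y\<close>.\<close>
  have "mX l0 (ldiv L l0 m, T m l0 y) = y"
    by (simp add: mX_ldiv_T)
  then have "m \<otimes> box_of_fam L G \<pi> l0 mX f m (T m l0 y) (ldiv L m l) (ldiv L m n)
      = F_of_fam f y l m n"
    by (simp add: box_of_fam_def F_of_fam_def)
  moreover have "mX m (ldiv L m n, T n l0 y) = T m l0 y"
    by (simp add: mX_ldiv_T)
  ultimately show "mod_of_fam L G \<pi> l0 mX f l (ldiv L l m, pt m n y) = pt l (F_of_fam f y l m n) y"
    using Fc by (simp add: mod_of_fam_def pt_def mX_ldiv_T Let_def)
qed

lemma represents_fam_of_mod: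
  assumes F: "represents F mY" and c: "x \<in> hcarrier X" "g \<in> carrier G"
  shows "fam_of_mod L G \<pi> l0 mX mY x g = inv\<^bsub>G\<^esub> \<pi> (F x (E g) l0 l0) \<otimes>\<^bsub>G\<^esub> g"
proof -
  \<comment> \<open>\<open>theta_Y\<close> is evaluated on the path \<open>l0, E g, l0, l0\<close>:
    \<open>mY\<close> acts from \<open>E g\<close>, and the trivial structure then drops
    \<open>E g\<close>.\<close>
  have "(\<one>, mX (l0 \<otimes> \<one>) (ldiv L (l0 \<otimes> \<one>) l0, x)) = pt l0 l0 x"
    using c by (simp add: r_one pt_def T_def)
  then have "box_of_mod L mX mY l0 x (ldiv L l0 (E g)) \<one> = ldiv L l0 (F x (E g) l0 l0)"
    using c representsD[OF F]
    by (simp add: box_of_mod_def theta_Y_def iota_def comp_mor_def assoc_def tensor_mor_def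
        id_mor_def) (simp add: pt_def)
  then show ?thesis
    using c representsD[OF F] by (simp add: fam_of_mod_def)
qed

lemma represents_admissible:
  assumes F: "represents F mY" and adm: "admissible L G \<pi> X mX mY" and y: "y \<in> hcarrier X"
  shows "fam_of_mod L G \<pi> l0 mX mY y \<in> hom G G"
    and "l \<in> carrier L \<Longrightarrow> m \<in> carrier L \<Longrightarrow> n \<in> carrier L \<Longrightarrow>
      F y l m n = F_of_fam (fam_of_mod L G \<pi> l0 mX mY) y l m n"
proof -
  note [simp] = y representsD(1)[OF F]
  have act: "F y l m (F y m n r) = F y l n r"
    if "l \<in> carrier L" "m \<in> carrier L" "n \<in> carrier L" "r \<in> carrier L" for l m n r
    using adm that y unfolding admissible_def represents_module_iff[OF F] by metis
  have triv: "F y (twist l m n) n r = F y l m r"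
    if "l \<in> carrier L" "m \<in> carrier L" "n \<in> carrier L" "r \<in> carrier L" for l m n r
    using adm that y unfolding admissible_def represents_braid_triv_iff[OF F] by metis
  have sigma: "F y l m (twist m n r) = twist l (twist l m n) (F y (twist l m n) n r)"
    if "l \<in> carrier L" "m \<in> carrier L" "n \<in> carrier L" "r \<in> carrier L" for l m n r
    using adm that y unfolding admissible_def represents_braid_sigma_iff[OF F] by metis
  \<comment> \<open>The middle vertex is normalized to \<open>l0\<close>, which corresponds to the
    unit of \<open>G\<close>; \<open>triv\<close> with \<open>n = l0\<close> reduces every
    \<open>F\<close> to this case.\<close>
  define K where "K g r = \<pi> (F y (E g) l0 (E r))" for g r
  have Kc [simp]: "K g r \<in> carrier G" if "g \<in> carrier G" "r \<in> carrier G" for g r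
    using that by (simp add: K_def)
  have K: "\<pi> (F y l m r) = K (\<pi> l \<otimes>\<^bsub>G\<^esub> inv\<^bsub>G\<^esub> \<pi> m) (\<pi> r)"
    if "l \<in> carrier L" "m \<in> carrier L" "r \<in> carrier L" for l m r
    using triv[of l m l0 r] that by (simp add: K_def twist_def)
  \<comment> \<open>The vertices \<open>gh\<close>, \<open>h\<close>, \<open>1\<close> have
    successive quotients \<open>g\<close> and \<open>h\<close>.\<close>
  have K_act: "K g (K h r) = K (g \<otimes>\<^bsub>G\<^esub> h) r"
    if "g \<in> carrier G" "h \<in> carrier G" "r \<in> carrier G" for g h r
    using arg_cong[OF act[of "E (g \<otimes>\<^bsub>G\<^esub> h)" "E h" l0 "E r"], of \<pi>] that
    by (simp add: K G.group_normalize)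
  \<comment> \<open>With vertices \<open>g, 1, inv h, r\<close> the inner twist on the left is
    \<open>hr\<close>, and on the right \<open>F\<close> starts at \<open>g (inv h)\<close>, so its
    quotient by \<open>inv h\<close> is again \<open>g\<close>.\<close>
  have K_conj: "K g (h \<otimes>\<^bsub>G\<^esub> r) = g \<otimes>\<^bsub>G\<^esub> h \<otimes>\<^bsub>G\<^esub> inv\<^bsub>G\<^esub> g \<otimes>\<^bsub>G\<^esub> K g r"
    if "g \<in> carrier G" "h \<in> carrier G" "r \<in> carrier G" for g h r
    using arg_cong[OF sigma[of "E g" l0 "E (inv\<^bsub>G\<^esub> h)" "E r"], of \<pi>] that
    by (simp add: K G.group_normalize)
  let ?f = "fam_of_mod L G \<pi> l0 mX mY y"
  have f: "?f g = inv\<^bsub>G\<^esub> K g \<one>\<^bsub>G\<^esub> \<otimes>\<^bsub>G\<^esub> g" if "g \<in> carrier G" for g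
    using that by (simp add: represents_fam_of_mod[OF F] K_def)
  have "(\<lambda>g. inv\<^bsub>G\<^esub> K g \<one>\<^bsub>G\<^esub> \<otimes>\<^bsub>G\<^esub> g) \<in> hom G G"
    by (rule G.twisted_action(1)) (fact Kc K_act K_conj)+
  then show f_hom: "?f \<in> hom G G"
    by (auto simp: hom_def Pi_iff f)
  have K_f: "K g r = g \<otimes>\<^bsub>G\<^esub> r \<otimes>\<^bsub>G\<^esub> inv\<^bsub>G\<^esub> ?f g" if "g \<in> carrier G" "r \<in> carrier G" for g r
    unfolding f[OF that(1)] by (rule G.twisted_action(2)) (fact Kc K_act K_conj that)+
  interpret f: group_hom G G ?f
    by unfold_locales (rule f_hom)
  show "F y l m n = F_of_fam (fam_of_mod L G \<pi> l0 mX mY) y l m n"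
    if "l \<in> carrier L" "m \<in> carrier L" "n \<in> carrier L"
  proof -
    have "\<pi> (F y l m n) = \<pi> l \<otimes>\<^bsub>G\<^esub> inv\<^bsub>G\<^esub> \<pi> m \<otimes>\<^bsub>G\<^esub> \<pi> n \<otimes>\<^bsub>G\<^esub>
        inv\<^bsub>G\<^esub> ?f (\<pi> l \<otimes>\<^bsub>G\<^esub> inv\<^bsub>G\<^esub> \<pi> m)"
      using that by (simp add: K K_f)
    also have "\<dots> = \<pi> l \<otimes>\<^bsub>G\<^esub> inv\<^bsub>G\<^esub> \<pi> m \<otimes>\<^bsub>G\<^esub> \<pi> n \<otimes>\<^bsub>G\<^esub> ?f (\<pi> m) \<otimes>\<^bsub>G\<^esub> inv\<^bsub>G\<^esub> ?f (\<pi> l)"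
      using that by (simp add: G.group_normalize)
    finally show ?thesis
      using that by (metis E_\<pi> F_of_fam_def representsD(1)[OF F] y)
  qed
qed

text \<open>In coordinates the module laws cancel directly, while the braid laws use
  multiplicativity to expand \<open>f\<close> at a twist.\<close>

lemma admissible_mod_of_fam:
  assumes f: "\<forall>x\<in>hcarrier X. f x \<in> hom G G"
  shows "admissible L G \<pi> X mX (mod_of_fam L G \<pi> l0 mX f)"
proof -
  have closed [simp]: "f y g \<in> carrier G" if "y \<in> hcarrier X" "g \<in> carrier G" for y g
    using f that by (auto simp: hom_def)
  have mult: "f y (g \<otimes>\<^bsub>G\<^esub> h) = f y g \<otimes>\<^bsub>G\<^esub> f y h"
    if "y \<in> hcarrier X" "g \<in> carrier G" "h \<in> carrier G" for y g h
    using f that by (auto simp: hom_def)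
  have inv: "f y (inv\<^bsub>G\<^esub> g) = inv\<^bsub>G\<^esub> f y g" if "y \<in> hcarrier X" "g \<in> carrier G" for y g
    using f that by (intro group_hom.hom_inv[of G G]) (auto intro!: group_hom.intro
        simp: group_hom_axioms_def G.group_axioms)
  show ?thesis
    unfolding admissible_def represents_module_iff[OF represents_mod_of_fam[OF f]]
      represents_braid_triv_iff[OF represents_mod_of_fam[OF f]]
      represents_braid_sigma_iff[OF represents_mod_of_fam[OF f]]
    using represents_mX[OF represents_mod_of_fam[OF f]]
    by (simp add: F_of_fam_def twist_def mult inv G.group_normalize)
qed

lemma fam_of_mod_of_fam:
  assumes f: "\<forall>x\<in>hcarrier X. f x \<in> hom G G" and c: "x \<in> hcarrier X" "g \<in> carrier G"
  shows "fam_of_mod L G \<pi> l0 mX (mod_of_fam L G \<pi> l0 mX f) x g = f x g"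
proof -
  have fc: "f x h \<in> carrier G" if "h \<in> carrier G" for h
    using f c that by (auto simp: hom_def)
  \<comment> \<open>The vertices \<open>E g, l0, l0\<close> leave the factor \<open>f x\<close> at
    the unit, which must vanish.\<close>
  have "f x \<one>\<^bsub>G\<^esub> = \<one>\<^bsub>G\<^esub>"
    using f c by (meson G.group_axioms hom_one)
  then show ?thesis
    using c fc by (simp add: represents_fam_of_mod[OF represents_mod_of_fam[OF f]] F_of_fam_def
        G.group_normalize)
qed

lemma mod_of_fam_of_mod:
  assumes adm: "admissible L G \<pi> X mX mY"
  shows "mor_eq (carrier L) (tensor_obj (L_obj L) (Y_obj L X))
    (mod_of_fam L G \<pi> l0 mX (fam_of_mod L G \<pi> l0 mX mY)) mY"
proof -
  obtain F where F: "represents F mY"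
    using admissible_represented[OF adm] .
  \<comment> \<open>Both structures have this same vertex function, hence agree as
    morphisms.\<close>
  have "represents (F_of_fam (fam_of_mod L G \<pi> l0 mX mY)) mY"
    using F represents_admissible(2)[OF F adm] by (simp add: represents_def)
  moreover have "\<forall>x\<in>hcarrier X. fam_of_mod L G \<pi> l0 mX mY x \<in> hom G G"
    using represents_admissible(1)[OF F adm] by blast
  ultimately show ?thesis
    by (intro represents_mor_eq[OF represents_mod_of_fam])
qed

end

theorem theorem6p10:
  fixes L :: "('l, 'b) monoid_scheme"
    and G :: "('g, 'c) monoid_scheme"
    and \<pi> :: "'l \<Rightarrow> 'g"
    and X :: "('l, 'x) hobj"
    and mX :: "('l, 'l \<times> 'x, 'x) hmor"
    and l0 :: 'l
  assumes "left_quasigroup_with_unit L"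
    and "group G"
    and "bij_betw \<pi> (carrier L) (carrier G)"
    and "L_module L X mX"
    and "l0 \<in> carrier L" and "\<pi> l0 = \<one>\<^bsub>G\<^esub>"
  shows
    "(\<forall>mY. admissible L G \<pi> X mX mY \<longrightarrow>
        (\<forall>x\<in>hcarrier X. fam_of_mod L G \<pi> l0 mX mY x \<in> hom G G))
     \<and>
     (\<forall>f. (\<forall>x\<in>hcarrier X. f x \<in> hom G G) \<longrightarrow>
        is_mor (carrier L) (tensor_obj (L_obj L) (Y_obj L X)) (Y_obj L X)
          (mod_of_fam L G \<pi> l0 mX f) \<and>
        admissible L G \<pi> X mX (mod_of_fam L G \<pi> l0 mX f))
     \<and>
     (\<forall>mY. admissible L G \<pi> X mX mY \<longrightarrow>
        mor_eq (carrier L) (tensor_obj (L_obj L) (Y_obj L X))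
          (mod_of_fam L G \<pi> l0 mX (fam_of_mod L G \<pi> l0 mX mY)) mY)
     \<and>
     (\<forall>f. (\<forall>x\<in>hcarrier X. f x \<in> hom G G) \<longrightarrow>
        (\<forall>x\<in>hcarrier X. \<forall>g\<in>carrier G.
           fam_of_mod L G \<pi> l0 mX (mod_of_fam L G \<pi> l0 mX f) x g = f x g))"
proof -
  interpret quasigroup_module L G \<pi> X mX l0
    using assms by (intro quasigroup_module.intro quasigroup_module_axioms.intro)
  have "fam_of_mod L G \<pi> l0 mX mY x \<in> hom G G"
    if "admissible L G \<pi> X mX mY" "x \<in> hcarrier X" for mY x
    using admissible_represented[OF that(1)] represents_admissible(1)[OF _ that] by metis
  then show ?thesis
    using represents_is_mor[OF represents_mod_of_fam] admissible_mod_of_fam mod_of_fam_of_mod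
      fam_of_mod_of_fam
    by simp
qed

end
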